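(* Let $\hat L$, $M$, $\psi_k$, $\Delta S$, $\overline D_\beta$, $\hat H$ and the discrete operators $[\cdot]$, $[\nabla\,\cdot]$, $\langle\cdot\rangle$, $\langle\nabla\cdot\,\cdot\rangle$ be as defined in the context. Let the particle positions $\boldsymbol X_\beta(t)$ and their associated local momenta $\overline{\boldsymbol m}_\beta(t)/\Delta S$, $\beta=1,\dots,n$, evolve by the canonical Hamilton's equations for $\hat H$, i.e. $$\dot{\boldsymbol X}_\beta=\Delta S\,\nabla_{\overline{\boldsymbol m}_\beta}\hat H,\qquad \frac{\dot{\overline{\boldsymbol m}}_\beta}{\Delta S}=-\nabla_{\boldsymbol X_\beta}\hat H,$$ where $\hat H$ is regarded as a function of $(\boldsymbol X_\beta,\overline{\boldsymbol m}_\beta)_{\beta=1}^n$, and let $\tilde{\boldsymbol u}$ be the corresponding grid velocity. (1) On the grid, the equations of motion take the following form, for $k=1,\dots,m$: $$\frac{d}{dt}\langle\overline{\boldsymbol m}\rangle_k+\big\langle\nabla\cdot([\tilde{\boldsymbol u}]\,\overline{\boldsymbol m})\big\rangle_k+\big\langle[(\nabla\tilde{\boldsymbol u})^T]\cdot\overline{\boldsymbol m}\big\rangle_k=\Big\langle\overline D\,\Big[\nabla M^{-1}\frac{\partial\hat L}{\partial\tilde D}\Big]\Big\rangle_k,$$ $$\partial_t\langle\overline D\rangle_k+\big\langle\nabla\cdot(\overline D\,[\tilde{\boldsymbol u}])\big\rangle_k=0,$$ $$\langle\overline{\boldsymbol m}\rangle_k=\sum_{l}(M^{-1})_{kl}\frac{\partial\hat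 L}{\partial\tilde{\boldsymbol u}_l},$$ which gives an approximation on the grid, using the discrete calculus defined in the context, to the Euler–Poincaré (EP) equations $$\partial_t\boldsymbol m+\nabla\cdot(\boldsymbol u\boldsymbol m)+(\nabla\boldsymbol u)^T\cdot\boldsymbol m=D\nabla\frac{\delta l}{\delta D},\qquad \partial_tD+\nabla\cdot(\boldsymbol uD)=0,\qquad \boldsymbol m=\frac{\delta l}{\delta\boldsymbol u}.$$ (2) Furthermore, at the particle locations the equations take the form, for $\beta=1,\dots,n$: $$\frac{d}{dt}\frac{\overline{\boldsymbol m}_\beta}{\overline D_\beta}+[(\nabla\tilde{\boldsymbol u})^T]_\beta\cdot\frac{\overline{\boldsymbol m}_\beta}{\overline D_\beta}=\Big[\nabla M^{-1}\frac{\partial\hat L}{\partial\tilde D}\Big]_\beta,\qquad \frac{d}{dt}\boldsymbol X_\beta=[\tilde{\boldsymbol u}]_\beta,$$ which gives an approximation at the particle locations to the EP equation in vector form $$\frac{D}{Dt}\frac{\boldsymbol m}{D}+(\nabla\boldsymbol u)^T\cdot\frac{\boldsymbol m}{D}=\nabla\frac{\delta l}{\delta D},\qquad \frac{D}{Dt}=\partial_t+\boldsymbol u\cdot\nabla.$$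
   Context: **Continuous problem.** $l=\int\lambda(\boldsymbol u,D)\,d^2x$ is a reduced Lagrangian, written as an integral over the domain $\mathcal D$; it is a functional of the Eulerian velocity $\boldsymbol u$ and the advected density $D$ (which satisfies the continuity equation), and $\lambda$ is a nonlinear operator. $\delta l/\delta\boldsymbol u$ and $\delta l/\delta D$ are its variational derivatives. **Domain, grid and basis functions.** $\mathcal D$ is a closed, compact two-dimensional manifold (e.g. a square with periodic boundaries). There are $m$ fixed Eulerian grid points $\boldsymbol x_1,\dots,\boldsymbol x_m$ and $n$ moving Lagrangian particles $\boldsymbol X_1,\dots,\boldsymbol X_n$ in $\mathcal D$. Roman indices label grid points and Greek indices particles; a tilde denotes a grid quantity and a bar a particle quantity. The basis functions are $\psi_k(\boldsymbol x)=\phi(\boldsymbol x_k;\boldsymbol x)$, where $\nabla_{\boldsymbol x}\phi(\boldsymbol y;\boldsymbol x)=-\nabla_{\boldsymbol y}\phi(\boldsymbol y;\boldsymbol x)$ and $\int_{\mathcal D}\phi(\boldsymbol x;\boldsymbol y)\,d^2x=\Delta S$, with $\Delta S$ a constant, and $\sum_k\psi_k(\boldsymbol x)=1$ for all $\boldsymbol x\in\mathcal D$. **Discrete Lagrangian.** $M=(M_{kl})$ is the (constant, invertible) matrix representing the approximation to integration on the grid (the mass matrix). The discrete Lagrangian is $$\hat L=\sum_{kl}M_{kl}\,\lambda_k\big(\{\tilde{\boldsymbol u}_j\}_{j=1}^m,\{\tilde D_j\}_{j=1}^m\big),$$ where $\lambda_k$ is a function approximating $\lambda$ at $\boldsymbol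 x_k$, with any differential operators replaced by matrix operations on the grid in a manner consistent with the choice of $M$. **Legendre transform.** The grid momentum $\tilde{\boldsymbol m}$ is given by $\sum_lM_{kl}\tilde{\boldsymbol m}_l=\partial\hat L/\partial\tilde{\boldsymbol u}_k$; this is solved for $\tilde{\boldsymbol u}$ as a function of $(\tilde{\boldsymbol m},\tilde D)$, and $$\hat H(\tilde{\boldsymbol m},\tilde D)=\sum_{kl}M_{kl}\,\tilde{\boldsymbol u}_k\cdot\tilde{\boldsymbol m}_l-\hat L.$$ **Particle variables.** Particle $\beta$ carries a momentum density $\overline{\boldsymbol m}_\beta$ and a (nonzero) density $\overline D_\beta$ constant in time. These are interpolated to the grid by $$\sum_lM_{kl}\tilde{\boldsymbol m}_l=\sum_\beta\frac{\overline{\boldsymbol m}_\beta}{\Delta S}\psi_k(\boldsymbol X_\beta),\qquad \sum_lM_{kl}\tilde D_l=\sum_\beta\frac{\overline D_\beta}{\Delta S}\psi_k(\boldsymbol X_\beta).$$ Substituting these into $\hat H(\tilde{\boldsymbol m},\tilde D)$ makes $\hat H$ a function of $(\boldsymbol X_\beta,\overline{\boldsymbol m}_\beta)_{\beta=1}^n$; the corresponding grid velocity is $\tilde{\boldsymbol u}(\tilde{\boldsymbol m},\tilde D)$. Derivatives of $\hat L(\tilde{\boldsymbol u},\tilde D)$ are partial derivatives, evaluated at these $\tilde{\boldsymbol u},\tilde D$. **Discrete calculus.** - Grid-to-particle map: $[\tilde f]_\beta=\sum_k\tilde f_k\psi_k(\boldsymbol X_\beta)$. - Grid-to-particle gradient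 map: $[\nabla\tilde f]_\beta=\sum_k\tilde f_k\nabla\psi_k(\boldsymbol X_\beta)$. For a vector $\boldsymbol v$, $[(\nabla\tilde{\boldsymbol u})^T]_\beta\cdot\boldsymbol v=\sum_k(\tilde{\boldsymbol u}_k\cdot\boldsymbol v)\nabla\psi_k(\boldsymbol X_\beta)$. The expression $[\nabla M^{-1}\partial\hat L/\partial\tilde D]_\beta$ means $\sum_{kl}\frac{\partial\hat L}{\partial\tilde D_k}(M^{-1})_{kl}\nabla\psi_l(\boldsymbol X_\beta)$, i.e. the gradient map applied to the grid function whose $l$-th value is $\sum_k\frac{\partial\hat L}{\partial\tilde D_k}(M^{-1})_{kl}$. - Particle-to-grid map: $\sum_lM_{kl}\langle\overline f\rangle_l=\sum_\beta\frac{\overline f_\beta}{\Delta S}\psi_k(\boldsymbol X_\beta)$, and for products with grid quantities $\sum_lM_{kl}\langle\overline f[\tilde g]\rangle_l=\sum_\beta\frac{\overline f_\beta}{\Delta S}[\tilde g]_\beta\psi_k(\boldsymbol X_\beta)$ (likewise when $[\tilde g]$ is replaced by a gradient-map quantity). In particular $\langle\overline{\boldsymbol m}\rangle=\tilde{\boldsymbol m}$ and $\langle\overline D\rangle=\tilde D$. - Particle-to-grid divergence map (the adjoint of the grid-to-particle gradient map): $\sum_lM_{kl}\langle\nabla\cdot\overline{\boldsymbol f}\rangle_l=-\sum_\beta\frac{\overline{\boldsymbol f}_\beta}{\Delta S}\cdot\nabla\psi_k(\boldsymbol X_\beta)$. For $[\tilde{\boldsymbol u}]\,\overline{\boldsymbol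 m}$ the gradient is contracted with $[\tilde{\boldsymbol u}]$: $\sum_lM_{kl}\langle\nabla\cdot([\tilde{\boldsymbol u}]\overline{\boldsymbol m})\rangle_l=-\sum_\beta\frac{\overline{\boldsymbol m}_\beta}{\Delta S}\,[\tilde{\boldsymbol u}]_\beta\cdot\nabla\psi_k(\boldsymbol X_\beta)$. *)

theory Defs
  imports "HOL-Analysis.Analysis"
begin

section \<open>The domain\<close>

text \<open>
  Gradients at different points of the domain are compared componentwise (in
  \<open>\<nabla>\<^sub>x \<phi>(y;x) = - \<nabla>\<^sub>y \<phi>(y;x)\<close>) and momenta sitting at different particles are added
  componentwise.  The domain is therefore a closed surface with an atlas whose coordinate changes are
  locally translations, so that \<open>\<nabla>\<close> has well-defined Cartesian components and \<open>d\<^sup>2x\<close>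
  is the Lebesgue measure in every chart.  The square with periodic boundaries is the
  standard example.  A chart is a pair of a domain \<open>V\<close> and a coordinate map \<open>c\<close>.
\<close>

locale closed_flat_surface =
  fixes S :: "'p topology"
    and atlas :: "('p set \<times> ('p \<Rightarrow> real^2)) set"
    and area :: "'p measure"
  assumes compact: "compact_space S"
    and Hausdorff: "Hausdorff_space S"
    and chart_dom: "\<And>V c. (V, c) \<in> atlas \<Longrightarrow> openin S V"
    and chart_range: "\<And>V c. (V, c) \<in> atlas \<Longrightarrow> open (c ` V)"
    and chart_homeo: "\<And>V c. (V, c) \<in> atlas \<Longrightarrow>
          homeomorphic_map (subtopology S V) (top_of_set (c ` V)) c"
    and cover: "topspace S = (\<Union>(V, c)\<in>atlas. V)"
    and chart_change: "\<And>V c V' c' p. \<lbrakk>(V, c) \<in> atlas; (V', c') \<in> atlas; p \<in> V \<inter> V'\<rbrakk> \<Longrightarrow>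
          \<exists>N a. openin S N \<and> p \<in> N \<and> N \<subseteq> V \<inter> V' \<and> (\<forall>q\<in>N. c' q = c q + a)"
    and space_area: "space area = topspace S"
    and sets_area: "sets area = sigma_sets (topspace S) {N. openin S N}"
    and emeasure_area: "\<And>V c B. \<lbrakk>(V, c) \<in> atlas; B \<in> sets area; B \<subseteq> V\<rbrakk> \<Longrightarrow>
          emeasure area B = emeasure lborel (c ` B)"

definition has_surface_gradient ::
  "('p set \<times> ('p \<Rightarrow> real^2)) set \<Rightarrow> ('p \<Rightarrow> real) \<Rightarrow> 'p \<Rightarrow> real^2 \<Rightarrow> bool" where
  "has_surface_gradient atlas f p g \<longleftrightarrow>
     (\<forall>(V, c)\<in>atlas. p \<in> V \<longrightarrow> GDERIV (\<lambda>y. f (inv_into V c y)) (c p) :> g)"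

definition surface_gradient ::
  "('p set \<times> ('p \<Rightarrow> real^2)) set \<Rightarrow> ('p \<Rightarrow> real) \<Rightarrow> 'p \<Rightarrow> real^2" where
  "surface_gradient atlas f p = (THE g. has_surface_gradient atlas f p g)"

text \<open>
  The limit makes the curve stay in the chart domain near time \<open>t\<close>, so that the
  derivative of the coordinates depends only on values of \<open>c\<close> inside \<open>V\<close>.
\<close>

definition has_surface_velocity ::
  "'p topology \<Rightarrow> ('p set \<times> ('p \<Rightarrow> real^2)) set \<Rightarrow> (real \<Rightarrow> 'p) \<Rightarrow> real \<Rightarrow> real^2 \<Rightarrow> bool" where
  "has_surface_velocity S atlas x t v \<longleftrightarrow>
     limitin S x (x t) (at t) \<and>
     (\<forall>(V, c)\<in>atlas. x t \<in> V \<longrightarrow> ((\<lambda>s. c (x s)) has_vector_derivative v) (at t))"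

definition grad :: "('a::real_inner \<Rightarrow> real) \<Rightarrow> 'a \<Rightarrow> 'a" where
  "grad f x = (THE g. GDERIV f x :> g)"


section \<open>Discrete Lagrangian and Legendre transform\<close>

definition vec_upd :: "'a^'m \<Rightarrow> 'm \<Rightarrow> 'a \<Rightarrow> 'a^'m" where
  "vec_upd v k a = (\<chi> j. if j = k then a else v $ j)"

definition Lhat ::
  "real^'m::finite^'m \<Rightarrow> ('m \<Rightarrow> (real^2)^'m \<Rightarrow> real^'m \<Rightarrow> real) \<Rightarrow> (real^2)^'m \<Rightarrow> real^'m \<Rightarrow> real" where
  "Lhat M lam u D = (\<Sum>k\<in>UNIV. \<Sum>l\<in>UNIV. M $ k $ l * lam k u D)"

definition dLhat_du ::
  "real^'m::finite^'m \<Rightarrow> ('m \<Rightarrow> (real^2)^'m \<Rightarrow> real^'m \<Rightarrow> real) \<Rightarrow> (real^2)^'m \<Rightarrow> real^'m \<Rightarrow> 'm \<Rightarrow> real^2" where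
  "dLhat_du M lam u D k = grad (\<lambda>v. Lhat M lam (vec_upd u k v) D) (u $ k)"

definition dLhat_dD ::
  "real^'m::finite^'m \<Rightarrow> ('m \<Rightarrow> (real^2)^'m \<Rightarrow> real^'m \<Rightarrow> real) \<Rightarrow> (real^2)^'m \<Rightarrow> real^'m \<Rightarrow> 'm \<Rightarrow> real" where
  "dLhat_dD M lam u D k = deriv (\<lambda>d. Lhat M lam u (vec_upd D k d)) (D $ k)"

text \<open>
  \<open>U m D\<close> is the grid velocity obtained by solving the momentum relation for \<open>u\<close>.  The
  relation need not be solvable for all \<open>(m, D)\<close> (for shallow water, \<open>m = D u\<close>
  requires nonzero \<open>D\<close>), hence the open set \<open>W\<close>.
\<close>

definition legendre_solution ::
  "real^'m::finite^'m \<Rightarrow> ('m \<Rightarrow> (real^2)^'m \<Rightarrow> real^'m \<Rightarrow> real) \<Rightarrow> (((real^2)^'m) \<times> (real^'m)) set \<Rightarrow>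
   ((real^2)^'m \<Rightarrow> real^'m \<Rightarrow> (real^2)^'m) \<Rightarrow> bool" where
  "legendre_solution M lam W U \<longleftrightarrow> open W \<and>
     (\<forall>(m, D)\<in>W.
        (\<lambda>(u, D'). Lhat M lam u D') differentiable (at (U m D, D)) \<and>
        (\<lambda>(m', D'). U m' D') differentiable (at (m, D)) \<and>
        (\<forall>k. (\<Sum>l\<in>UNIV. M $ k $ l *\<^sub>R m $ l) = dLhat_du M lam (U m D) D k))"

definition Hhat ::
  "real^'m::finite^'m \<Rightarrow> ('m \<Rightarrow> (real^2)^'m \<Rightarrow> real^'m \<Rightarrow> real) \<Rightarrow>
   ((real^2)^'m \<Rightarrow> real^'m \<Rightarrow> (real^2)^'m) \<Rightarrow> (real^2)^'m \<Rightarrow> real^'m \<Rightarrow> real" where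
  "Hhat M lam U m D =
     (\<Sum>k\<in>UNIV. \<Sum>l\<in>UNIV. M $ k $ l * (U m D $ k \<bullet> m $ l)) - Lhat M lam (U m D) D"


section \<open>Discrete calculus\<close>

text \<open>
  Grid quantities are vectors over the index type \<open>'m\<close>; particle quantities are functions
  on the index type \<open>'n\<close>.  Throughout, \<open>psi k\<close> is the basis function of grid point \<open>k\<close>
  and \<open>X\<close> gives the particle positions.
\<close>

definition mass_solve :: "real^'m::finite^'m \<Rightarrow> ('m \<Rightarrow> 'v) \<Rightarrow> ('v::real_vector)^'m" where
  "mass_solve M b = (THE g. \<forall>k. (\<Sum>l\<in>UNIV. M $ k $ l *\<^sub>R g $ l) = b k)"

lemma mass_solve_iff:
  fixes M :: "real^'m::finite^'m" and g :: "('v::real_vector)^'m"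
  assumes "invertible M"
  shows "g = mass_solve M b \<longleftrightarrow> (\<forall>k. (\<Sum>l\<in>UNIV. M $ k $ l *\<^sub>R g $ l) = b k)"
proof -
  let ?N = "matrix_inv M"
  have MN: "M ** ?N = mat 1" and NM: "?N ** M = mat 1"
    using someI_ex[OF assms[unfolded invertible_def]] unfolding matrix_inv_def by simp_all
  have comp: "(\<Sum>l\<in>UNIV. A $ k $ l *\<^sub>R (\<Sum>j\<in>UNIV. B $ l $ j *\<^sub>R h j)) = h k"
    if "A ** B = mat 1" for A B :: "real^'m^'m" and h :: "'m \<Rightarrow> 'v" and k
  proof -
    have "(\<Sum>l\<in>UNIV. A $ k $ l *\<^sub>R (\<Sum>j\<in>UNIV. B $ l $ j *\<^sub>R h j))
        = (\<Sum>j\<in>UNIV. \<Sum>l\<in>UNIV. (A $ k $ l * B $ l $ j) *\<^sub>R h j)"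
      by (simp add: scaleR_sum_right) (rule sum.swap)
    also have "\<dots> = (\<Sum>j\<in>UNIV. (A ** B) $ k $ j *\<^sub>R h j)"
      by (simp add: matrix_matrix_mult_def scaleR_sum_left)
    also have "\<dots> = (\<Sum>j\<in>UNIV. if j = k then h j else 0)"
      unfolding that by (rule sum.cong) (auto simp: mat_def)
    also have "\<dots> = h k" by simp
    finally show ?thesis .
  qed
  define g0 where "g0 = (\<chi> k. \<Sum>j\<in>UNIV. ?N $ k $ j *\<^sub>R b j)"
  have sol: "\<forall>k. (\<Sum>l\<in>UNIV. M $ k $ l *\<^sub>R g0 $ l) = b k"
    by (simp add: g0_def comp[OF MN])
  have uniq: "g' = g0" if "\<forall>k. (\<Sum>l\<in>UNIV. M $ k $ l *\<^sub>R g' $ l) = b k" for g'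
    using comp[OF NM, where h = "\<lambda>k. g' $ k"] that by (simp add: vec_eq_iff g0_def)
  have "mass_solve M b = g0"
    unfolding mass_solve_def using sol uniq by (rule the_equality)
  with sol uniq show ?thesis by blast
qed

definition to_particle ::
  "('m \<Rightarrow> 'p \<Rightarrow> real) \<Rightarrow> ('n \<Rightarrow> 'p) \<Rightarrow> ('v::real_vector)^'m \<Rightarrow> 'n \<Rightarrow> 'v" where
  "to_particle psi X f \<beta> = (\<Sum>k\<in>UNIV. psi k (X \<beta>) *\<^sub>R f $ k)"

definition grad_to_particle ::
  "('p set \<times> ('p \<Rightarrow> real^2)) set \<Rightarrow> ('m \<Rightarrow> 'p \<Rightarrow> real) \<Rightarrow> ('n \<Rightarrow> 'p) \<Rightarrow> real^'m \<Rightarrow> 'n \<Rightarrow> real^2" where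
  "grad_to_particle atlas psi X f \<beta> =
     (\<Sum>k\<in>UNIV. f $ k *\<^sub>R surface_gradient atlas (psi k) (X \<beta>))"

definition gradT_to_particle ::
  "('p set \<times> ('p \<Rightarrow> real^2)) set \<Rightarrow> ('m \<Rightarrow> 'p \<Rightarrow> real) \<Rightarrow> ('n \<Rightarrow> 'p) \<Rightarrow>
   (real^2)^'m \<Rightarrow> 'n \<Rightarrow> real^2 \<Rightarrow> real^2" where
  "gradT_to_particle atlas psi X u \<beta> v =
     (\<Sum>k\<in>UNIV. (u $ k \<bullet> v) *\<^sub>R surface_gradient atlas (psi k) (X \<beta>))"

definition to_grid ::
  "real^'m::finite^'m \<Rightarrow> ('m \<Rightarrow> 'p \<Rightarrow> real) \<Rightarrow> real \<Rightarrow> ('n::finite \<Rightarrow> 'p) \<Rightarrow>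
   ('n \<Rightarrow> 'v) \<Rightarrow> ('v::real_vector)^'m" where
  "to_grid M psi \<Delta>S X f =
     mass_solve M (\<lambda>k. \<Sum>\<beta>\<in>UNIV. psi k (X \<beta>) *\<^sub>R (f \<beta> /\<^sub>R \<Delta>S))"

definition div_to_grid ::
  "('p set \<times> ('p \<Rightarrow> real^2)) set \<Rightarrow> real^'m^'m \<Rightarrow> ('m \<Rightarrow> 'p \<Rightarrow> real) \<Rightarrow> real \<Rightarrow>
   ('n::finite \<Rightarrow> 'p) \<Rightarrow> ('n \<Rightarrow> real^2) \<Rightarrow> real^'m" where
  "div_to_grid atlas M psi \<Delta>S X f =
     mass_solve M (\<lambda>k. - (\<Sum>\<beta>\<in>UNIV. (f \<beta> /\<^sub>R \<Delta>S) \<bullet> surface_gradient atlas (psi k) (X \<beta>)))"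

text \<open>The divergence of the particle tensor \<open>v w\<close>, with the gradient contracted with \<open>v\<close>.\<close>

definition tensor_div_to_grid ::
  "('p set \<times> ('p \<Rightarrow> real^2)) set \<Rightarrow> real^'m^'m \<Rightarrow> ('m \<Rightarrow> 'p \<Rightarrow> real) \<Rightarrow> real \<Rightarrow>
   ('n::finite \<Rightarrow> 'p) \<Rightarrow> ('n \<Rightarrow> real^2) \<Rightarrow> ('n \<Rightarrow> real^2) \<Rightarrow> (real^2)^'m" where
  "tensor_div_to_grid atlas M psi \<Delta>S X v w =
     mass_solve M (\<lambda>k. - (\<Sum>\<beta>\<in>UNIV.
       (v \<beta> \<bullet> surface_gradient atlas (psi k) (X \<beta>)) *\<^sub>R (w \<beta> /\<^sub>R \<Delta>S)))"

text \<open>The grid function \<open>M\<inverse> \<partial>L/\<partial>D\<close>, with the first index of \<open>M\<inverse>\<close> contracted.\<close>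

definition Minv_dLhat_dD ::
  "real^'m::finite^'m \<Rightarrow> ('m \<Rightarrow> (real^2)^'m \<Rightarrow> real^'m \<Rightarrow> real) \<Rightarrow> (real^2)^'m \<Rightarrow> real^'m \<Rightarrow> real^'m" where
  "Minv_dLhat_dD M lam u D = (\<chi> l. \<Sum>k\<in>UNIV. dLhat_dD M lam u D k * matrix_inv M $ k $ l)"


section \<open>The Hamiltonian in particle variables\<close>

definition particle_Hhat ::
  "real^'m::finite^'m \<Rightarrow> ('m \<Rightarrow> (real^2)^'m \<Rightarrow> real^'m \<Rightarrow> real) \<Rightarrow>
   ((real^2)^'m \<Rightarrow> real^'m \<Rightarrow> (real^2)^'m) \<Rightarrow> ('m \<Rightarrow> 'p \<Rightarrow> real) \<Rightarrow> real \<Rightarrow> ('n \<Rightarrow> real) \<Rightarrow>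
   ('n::finite \<Rightarrow> 'p) \<Rightarrow> ('n \<Rightarrow> real^2) \<Rightarrow> real" where
  "particle_Hhat M lam U psi \<Delta>S Db X mb =
     Hhat M lam U (to_grid M psi \<Delta>S X mb) (to_grid M psi \<Delta>S X Db)"

definition hamilton_equations ::
  "'p topology \<Rightarrow> ('p set \<times> ('p \<Rightarrow> real^2)) set \<Rightarrow> real \<Rightarrow>
   (('n \<Rightarrow> 'p) \<Rightarrow> ('n \<Rightarrow> real^2) \<Rightarrow> real) \<Rightarrow>
   (real \<Rightarrow> 'n \<Rightarrow> 'p) \<Rightarrow> (real \<Rightarrow> 'n \<Rightarrow> real^2) \<Rightarrow> real \<Rightarrow> bool" where
  "hamilton_equations S atlas \<Delta>S H X mb t \<longleftrightarrow>
     (\<forall>\<beta>. has_surface_velocity S atlas (\<lambda>s. X s \<beta>) t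
            (\<Delta>S *\<^sub>R grad (\<lambda>p. H (X t) ((mb t)(\<beta> := p))) (mb t \<beta>)) \<and>
          (\<lambda>s. mb s \<beta>) differentiable (at t) \<and>
          vector_derivative (\<lambda>s. mb s \<beta>) (at t) /\<^sub>R \<Delta>S =
            - surface_gradient atlas (\<lambda>x. H ((X t)(\<beta> := x)) (mb t)) (X t \<beta>))"

end

theory Submission
  imports Defs
begin

text \<open>
  By the momentum relation, \<open>d H = \<Sum>\<^sub>k u\<^sub>k \<bullet> d (M m)\<^sub>k - \<Sum>\<^sub>l (M\<inverse> \<partial>L/\<partial>D)\<^sub>l d (M D)\<^sub>l\<close>. In the
  particle variables, \<open>M m\<close> and \<open>M D\<close> are explicit sums over particles of basis functions, so the
  canonical equations say that particle \<open>\<beta>\<close> moves with the interpolated velocity and that its momentum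
  changes at the rate \<open>Db \<beta> [\<nabla> M\<inverse> \<partial>L/\<partial>D]\<^sub>\<beta> - [(\<nabla> u)\<^sup>T]\<^sub>\<beta> \<bullet> m\<^sub>\<beta>\<close>. Differentiating the defining sums of
  the grid quantities along these trajectories gives the grid equations, the divergence terms coming
  from the motion of the arguments of the basis functions.
\<close>

section \<open>Gradients in Euclidean space\<close>

lemma GDERIV_unique:
  assumes "GDERIV f x :> g" "GDERIV f x :> g'"
  shows "g = g'"
proof -
  have "(\<lambda>h. h \<bullet> g) = (\<lambda>h. h \<bullet> g')"
    using assms unfolding gderiv_def by (rule has_derivative_unique)
  then have "h \<bullet> g = h \<bullet> g'" for h
    by (rule fun_cong)
  then show ?thesis
    by (metis vector_eq_ldot)
qed

lemma grad_eqI: "GDERIV f x :> g \<Longrightarrow> grad f x = g"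
  unfolding grad_def by (rule the_equality) (auto intro: GDERIV_unique)

text \<open>In finite dimension every linear functional is the inner product with a fixed vector,
  here the sum of \<open>f' b *\<^sub>R b\<close> over the basis. That vector is a gradient, and by
  uniqueness it is the one that \<open>grad\<close> picks.\<close>

lemma has_derivative_eq_inner_grad:
  fixes f :: "'a::euclidean_space \<Rightarrow> real"
  assumes "(f has_derivative f') (at x)"
  shows "f' h = h \<bullet> grad f x"
proof -
  interpret linear f'
    using assms by (rule has_derivative_linear)
  have rep: "f' h = h \<bullet> (\<Sum>b\<in>Basis. f' b *\<^sub>R b)" for h
  proof -
    have "f' h = f' (\<Sum>b\<in>Basis. (h \<bullet> b) *\<^sub>R b)"
      by (simp add: euclidean_representation)
    also have "\<dots> = h \<bullet> (\<Sum>b\<in>Basis. f' b *\<^sub>R b)"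
      by (simp add: sum scale inner_sum_right mult.commute)
    finally show ?thesis .
  qed
  then have "f' = (\<lambda>h. h \<bullet> (\<Sum>b\<in>Basis. f' b *\<^sub>R b))"
    by blast
  with assms have "GDERIV f x :> (\<Sum>b\<in>Basis. f' b *\<^sub>R b)"
    unfolding gderiv_def by metis
  then have "grad f x = (\<Sum>b\<in>Basis. f' b *\<^sub>R b)"
    by (rule grad_eqI)
  then show ?thesis
    using rep by metis
qed

section \<open>Derivatives of the Lagrangian and the Hamiltonian in the grid variables\<close>

text \<open>Writes the variation of one grid value as an affine map, whose derivative is the linear
  map \<open>axis k\<close> at every point.\<close>

lemma vec_upd_conv_axis:
  fixes u :: "('a::ab_group_add)^'m::finite"
  shows "vec_upd u k v = u + axis k (v - u $ k)"
  by (auto simp: vec_upd_def vec_eq_iff axis_def)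

lemma bounded_linear_axis: "bounded_linear (axis k :: 'a::real_normed_vector \<Rightarrow> 'a^'m::finite)"
  by (rule bounded_linear_intro [where K = 1])
    (auto simp: vec_eq_iff axis_def norm_vec_def L2_set_def if_distrib [of norm]
      if_distrib [of "\<lambda>x. x\<^sup>2"] cong: if_cong)

lemma has_derivative_vec_upd:
  fixes u :: "('a::real_normed_vector)^'m::finite"
  shows "(vec_upd u k has_derivative axis k) (at v)"
  unfolding vec_upd_conv_axis [abs_def]
  by (rule has_derivative_eq_rhs)
    (auto intro!: derivative_eq_intros bounded_linear.has_derivative [OF bounded_linear_axis])

lemma vec_upd_same: "vec_upd u k (u $ k) = u"
  by (auto simp: vec_upd_def vec_eq_iff)

lemma sum_axis: "(\<Sum>k\<in>UNIV. axis k (x $ k)) = (x :: ('a::real_normed_vector)^'m::finite)"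
  by (simp add: vec_eq_iff axis_def)

text \<open>Links the total derivative, which the chain rule needs, to the partial derivatives,
  which the definitions use. The chain rule along each coordinate slice evaluates \<open>L'\<close>
  on axis directions, and these span by linearity.\<close>

lemma Lhat_derivative:
  fixes u :: "(real^2)^'m::finite" and D :: "real^'m"
  assumes L': "((\<lambda>(u, D'). Lhat M lam u D') has_derivative L') (at (u, D))"
  shows "L' (du, dD) =
    (\<Sum>k\<in>UNIV. du $ k \<bullet> dLhat_du M lam u D k) + (\<Sum>k\<in>UNIV. dD $ k * dLhat_dD M lam u D k)"
proof -
  interpret L': linear L'
    using L' by (rule has_derivative_linear)
  have u: "L' (axis k v, 0) = v \<bullet> dLhat_du M lam u D k" for k v
  proof -
    have "((\<lambda>v. (vec_upd u k v, D)) has_derivative (\<lambda>v. (axis k v, 0))) (at (u $ k))"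
      by (intro has_derivative_Pair has_derivative_vec_upd has_derivative_const)
    from has_derivative_compose [OF this, of "\<lambda>(u, D'). Lhat M lam u D'" L'] L'
    have "((\<lambda>v. Lhat M lam (vec_upd u k v) D) has_derivative (\<lambda>v. L' (axis k v, 0))) (at (u $ k))"
      by (simp add: vec_upd_same)
    from has_derivative_eq_inner_grad [OF this] show ?thesis
      by (simp add: dLhat_du_def)
  qed
  have D: "L' (0, axis k d) = d * dLhat_dD M lam u D k" for k d
  proof -
    have "((\<lambda>d. (u, vec_upd D k d)) has_derivative (\<lambda>d. (0, axis k d))) (at (D $ k))"
      by (intro has_derivative_Pair has_derivative_vec_upd has_derivative_const)
    from has_derivative_compose [OF this, of "\<lambda>(u, D'). Lhat M lam u D'" L'] L'
    have d: "((\<lambda>d. Lhat M lam u (vec_upd D k d)) has_derivative (\<lambda>d. L' (0, axis k d))) (at (D $ k))"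
      by (simp add: vec_upd_same)
    \<comment> \<open>A linear functional on the reals is multiplication by a constant
      \<open>c\<close>, which is what \<open>deriv\<close> returns.\<close>
    then obtain c where "\<And>d. L' (0, axis k d) = d * c"
      using has_derivative_bounded_linear [OF d] unfolding real_bounded_linear by metis
    then have c: "(\<lambda>d. L' (0, axis k d)) = (*) c"
      by (simp add: fun_eq_iff mult.commute)
    from d have "((\<lambda>d. Lhat M lam u (vec_upd D k d)) has_field_derivative c) (at (D $ k))"
      unfolding has_field_derivative_def c .
    then have "dLhat_dD M lam u D k = c"
      unfolding dLhat_dD_def by (rule DERIV_imp_deriv)
    with fun_cong [OF c, of d] show ?thesis
      by (simp only: mult.commute)
  qed
  have "(du, dD) = (\<Sum>k\<in>UNIV. (axis k (du $ k), 0)) + (\<Sum>k\<in>UNIV. (0, axis k (dD $ k)))"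
    by (simp add: sum_prod sum_axis)
  then have "L' (du, dD) =
      (\<Sum>k\<in>UNIV. L' (axis k (du $ k), 0)) + (\<Sum>k\<in>UNIV. L' (0, axis k (dD $ k)))"
    by (simp only: L'.add L'.sum)
  then show ?thesis
    by (simp only: u D)
qed

text \<open>
  The variation of \<open>U\<close> contributes nothing, because its two occurrences cancel by the momentum
  relation.
\<close>

lemma Hhat_has_derivative:
  assumes leg: "legendre_solution M lam W U" and W: "(m, D) \<in> W"
  shows "((\<lambda>(m', D'). Hhat M lam U m' D') has_derivative
    (\<lambda>(dm, dD). (\<Sum>k\<in>UNIV. \<Sum>l\<in>UNIV. M $ k $ l * (U m D $ k \<bullet> dm $ l))
       - (\<Sum>k\<in>UNIV. dD $ k * dLhat_dD M lam (U m D) D k))) (at (m, D))"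
proof -
  let ?u = "U m D"
  from leg W obtain L' U'
    where L': "((\<lambda>(u, D'). Lhat M lam u D') has_derivative L') (at (?u, D))"
      and U': "((\<lambda>(m', D'). U m' D') has_derivative U') (at (m, D))"
      and mom: "\<And>k. (\<Sum>l\<in>UNIV. M $ k $ l *\<^sub>R m $ l) = dLhat_du M lam ?u D k"
    unfolding legendre_solution_def differentiable_def by blast
  have U'2: "((\<lambda>z. U (fst z) (snd z)) has_derivative U') (at (m, D))"
    using U' by (simp add: case_prod_beta')
  have "((\<lambda>z. (U (fst z) (snd z), snd z)) has_derivative (\<lambda>h. (U' h, snd h))) (at (m, D))"
    by (intro has_derivative_Pair U'2 has_derivative_snd has_derivative_ident)
  from has_derivative_compose [OF this, of "\<lambda>(u, D'). Lhat M lam u D'" L'] L'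
  have L2: "((\<lambda>z. Lhat M lam (U (fst z) (snd z)) (snd z)) has_derivative (\<lambda>h. L' (U' h, snd h)))
      (at (m, D))"
    by simp
  have Uk: "((\<lambda>z. U (fst z) (snd z) $ k) has_derivative (\<lambda>h. U' h $ k)) (at (m, D))" for k
    using U'2 by (rule bounded_linear.has_derivative [OF bounded_linear_vec_nth])
  have mk: "((\<lambda>z. fst z $ k) has_derivative (\<lambda>h. fst h $ k)) (at (m, D))" for k
    by (intro bounded_linear.has_derivative [OF bounded_linear_vec_nth]
        has_derivative_fst has_derivative_ident)
  have "((\<lambda>z. Hhat M lam U (fst z) (snd z)) has_derivative
     (\<lambda>h. (\<Sum>k\<in>UNIV. \<Sum>l\<in>UNIV. M $ k $ l * (?u $ k \<bullet> fst h $ l + U' h $ k \<bullet> m $ l))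
        - L' (U' h, snd h))) (at (m, D))"
    unfolding Hhat_def
    by (intro has_derivative_diff has_derivative_sum has_derivative_mult_right L2)
      (use has_derivative_inner [OF Uk mk] in simp)
  moreover have "(\<Sum>k\<in>UNIV. \<Sum>l\<in>UNIV. M $ k $ l * (?u $ k \<bullet> fst h $ l + U' h $ k \<bullet> m $ l))
        - L' (U' h, snd h) =
      (\<Sum>k\<in>UNIV. \<Sum>l\<in>UNIV. M $ k $ l * (?u $ k \<bullet> fst h $ l))
       - (\<Sum>k\<in>UNIV. snd h $ k * dLhat_dD M lam ?u D k)" for h
  proof -
    have "(\<Sum>l\<in>UNIV. M $ k $ l * (U' h $ k \<bullet> m $ l)) = U' h $ k \<bullet> dLhat_du M lam ?u D k" for k
      by (simp flip: mom add: inner_sum_right)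
    then show ?thesis
      by (simp add: Lhat_derivative [OF L'] distrib_left sum.distrib)
  qed
  ultimately show ?thesis
    by (simp add: case_prod_beta')
qed

section \<open>Differentiation through the mass matrix\<close>

lemma mass_solve_solves:
  assumes "invertible M"
  shows "(\<Sum>l\<in>UNIV. M $ k $ l *\<^sub>R mass_solve M b $ l) = b k"
  using mass_solve_iff [OF assms, of "mass_solve M b" b] by blast

text \<open>Replaces the definite description by a finite sum with constant coefficients, which can
  be differentiated and split termwise.\<close>

lemma mass_solve_nth:
  fixes M :: "real^'m::finite^'m"
  assumes "invertible M"
  shows "mass_solve M b $ k = (\<Sum>j\<in>UNIV. matrix_inv M $ k $ j *\<^sub>R b j)"
proof -
  have NM: "matrix_inv M ** M = mat 1"
    using someI_ex[OF assms[unfolded invertible_def]] unfolding matrix_inv_def by simp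
  let ?g = "mass_solve M b"
  have "(\<Sum>j\<in>UNIV. matrix_inv M $ k $ j *\<^sub>R b j)
      = (\<Sum>j\<in>UNIV. matrix_inv M $ k $ j *\<^sub>R (\<Sum>l\<in>UNIV. M $ j $ l *\<^sub>R ?g $ l))"
    by (simp add: mass_solve_solves [OF assms])
  also have "\<dots> = (\<Sum>l\<in>UNIV. \<Sum>j\<in>UNIV. (matrix_inv M $ k $ j * M $ j $ l) *\<^sub>R ?g $ l)"
    by (simp add: scaleR_sum_right) (rule sum.swap)
  also have "\<dots> = (\<Sum>l\<in>UNIV. (matrix_inv M ** M) $ k $ l *\<^sub>R ?g $ l)"
    by (simp add: matrix_matrix_mult_def scaleR_sum_left)
  also have "\<dots> = (\<Sum>l\<in>UNIV. if l = k then ?g $ l else 0)"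
    unfolding NM by (rule sum.cong) (auto simp: mat_def)
  finally show ?thesis by simp
qed

text \<open>The solution depends linearly on the right-hand side, with coefficients from the
  constant inverse matrix, so solving commutes with differentiation.\<close>

lemma has_derivative_mass_solve:
  fixes b :: "'m::finite \<Rightarrow> 'a::real_normed_vector \<Rightarrow> 'v::real_normed_vector"
  assumes "invertible M" and "\<And>k. (b k has_derivative b' k) (at x)"
  shows "((\<lambda>y. mass_solve M (\<lambda>k. b k y)) has_derivative (\<lambda>h. mass_solve M (\<lambda>k. b' k h))) (at x)"
proof -
  have *: "mass_solve M c = (\<Sum>k\<in>UNIV. axis k (\<Sum>j\<in>UNIV. matrix_inv M $ k $ j *\<^sub>R c j))"
    for c :: "'m \<Rightarrow> 'v"
    unfolding mass_solve_nth [OF assms(1), symmetric] by (rule sum_axis [symmetric])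
  show ?thesis
    unfolding * using assms(2)
    by (intro has_derivative_sum bounded_linear.has_derivative [OF bounded_linear_axis]
        has_derivative_scaleR_right)
qed

text \<open>The particle sums prescribe \<open>M m\<close> and \<open>M D\<close> rather than
  \<open>m\<close> and \<open>D\<close>, so the derivative is expressed in variations of these
  right-hand sides. In the momentum term \<open>M\<close> cancels the solve; in the density term the
  inverse is moved onto \<open>dLhat_dD\<close>.\<close>

lemma Hhat_mass_solve_has_derivative:
  fixes b :: "'m::finite \<Rightarrow> 'a::real_normed_vector \<Rightarrow> real^2" and d :: "'m \<Rightarrow> 'a \<Rightarrow> real"
  assumes leg: "legendre_solution M lam W U" and inv: "invertible M"
    and b: "\<And>k. (b k has_derivative b' k) (at x)"
    and d: "\<And>k. (d k has_derivative d' k) (at x)"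
    and m: "m = mass_solve M (\<lambda>k. b k x)" and D: "D = mass_solve M (\<lambda>k. d k x)"
    and W: "(m, D) \<in> W"
  shows "((\<lambda>y. Hhat M lam U (mass_solve M (\<lambda>k. b k y)) (mass_solve M (\<lambda>k. d k y))) has_derivative
    (\<lambda>h. (\<Sum>k\<in>UNIV. U m D $ k \<bullet> b' k h)
       - (\<Sum>k\<in>UNIV. Minv_dLhat_dD M lam (U m D) D $ k * d' k h))) (at x)"
proof -
  have "((\<lambda>y. (mass_solve M (\<lambda>k. b k y), mass_solve M (\<lambda>k. d k y))) has_derivative
      (\<lambda>h. (mass_solve M (\<lambda>k. b' k h), mass_solve M (\<lambda>k. d' k h)))) (at x)"
    by (intro has_derivative_Pair has_derivative_mass_solve inv b d)
  from has_derivative_compose [OF this, folded m D, OF Hhat_has_derivative [OF leg W]]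
  have H: "((\<lambda>y. Hhat M lam U (mass_solve M (\<lambda>k. b k y)) (mass_solve M (\<lambda>k. d k y))) has_derivative
     (\<lambda>h. (\<Sum>k\<in>UNIV. \<Sum>l\<in>UNIV. M $ k $ l * (U m D $ k \<bullet> mass_solve M (\<lambda>k. b' k h) $ l))
       - (\<Sum>k\<in>UNIV. mass_solve M (\<lambda>k. d' k h) $ k * dLhat_dD M lam (U m D) D k))) (at x)"
    by simp
  have 1: "(\<Sum>l\<in>UNIV. M $ k $ l * (v \<bullet> mass_solve M c $ l)) = v \<bullet> c k" for k v and c :: "'m \<Rightarrow> real^2"
    by (subst mass_solve_solves [OF inv, symmetric]) (simp add: inner_sum_right)
  \<comment> \<open>Exchanging the sums contracts the first index of the inverse with the derivative
    of the Lagrangian, which is the index order in \<open>Minv_dLhat_dD\<close>.\<close>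
  have 2: "(\<Sum>k\<in>UNIV. mass_solve M c $ k * dLhat_dD M lam (U m D) D k)
      = (\<Sum>k\<in>UNIV. Minv_dLhat_dD M lam (U m D) D $ k * c k)" for c :: "'m \<Rightarrow> real"
    by (simp add: mass_solve_nth [OF inv] Minv_dLhat_dD_def sum_distrib_left sum_distrib_right mult_ac)
      (rule sum.swap)
  show ?thesis
    using H by (simp only: 1 2)
qed

section \<open>Gradients and the chain rule on the surface\<close>

context closed_flat_surface
begin

lemma inv_into_chart:
  assumes "(V, c) \<in> atlas" "p \<in> V"
  shows "inv_into V c (c p) = p"
proof -
  have "topspace (subtopology S V) = V"
    using openin_subset [OF chart_dom [OF assms(1)]] by auto
  moreover have "inj_on c (topspace (subtopology S V))"
    using chart_homeo [OF assms(1)]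
    by (simp add: homeomorphic_eq_everything_map)
  ultimately show ?thesis
    using assms(2) by simp
qed

text \<open>Some chart contains \<open>p\<close> because the charts cover the surface, and
  uniqueness of the Euclidean gradient in that chart suffices. Outside \<open>topspace S\<close> no
  chart applies and every vector would vacuously be a gradient.\<close>

lemma surface_gradient_eqI:
  assumes "p \<in> topspace S" "has_surface_gradient atlas f p g"
  shows "surface_gradient atlas f p = g"
proof -
  obtain V c where Vc: "(V, c) \<in> atlas" "p \<in> V"
    using assms(1) cover by auto
  show ?thesis
    unfolding surface_gradient_def
  proof (rule the_equality)
    show "g' = g" if "has_surface_gradient atlas f p g'" for g'
      using that assms(2) Vc unfolding has_surface_gradient_def by (blast intro: GDERIV_unique)
  qed (rule assms(2))
qed

text \<open>The Euclidean chain rule in one chart around \<open>x t\<close>: the curve is pushed to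
  coordinates by \<open>c\<close> and \<open>f\<close> is pulled back by the inverse of
  \<open>c\<close>.\<close>

lemma has_vector_derivative_along_curve:
  assumes "x t \<in> topspace S"
    and f: "has_surface_gradient atlas f (x t) g" and x: "has_surface_velocity S atlas x t v"
  shows "((\<lambda>s. f (x s)) has_vector_derivative (v \<bullet> g)) (at t)"
proof -
  obtain V c where Vc: "(V, c) \<in> atlas" "x t \<in> V"
    using assms(1) cover by auto
  have fc: "((\<lambda>y. f (inv_into V c y)) has_derivative (\<lambda>h. h \<bullet> g)) (at (c (x t)))"
    using f Vc unfolding has_surface_gradient_def gderiv_def by blast
  have xc: "((\<lambda>s. c (x s)) has_derivative (\<lambda>h. h *\<^sub>R v)) (at t)"
    using x Vc unfolding has_surface_velocity_def has_vector_derivative_def by blast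
  \<comment> \<open>The inverse undoes \<open>c\<close> only inside \<open>V\<close>. The limit
    clause of the velocity keeps the curve there near \<open>t\<close>; the filter
    \<open>at t\<close> leaves out \<open>t\<close> itself, where the values are matched separately
    below.\<close>
  have ev: "\<forall>\<^sub>F s in at t. x s \<in> V"
    using x Vc chart_dom unfolding has_surface_velocity_def limitin_def by blast
  have "((\<lambda>s. f (inv_into V c (c (x s)))) has_derivative (\<lambda>h. (h *\<^sub>R v) \<bullet> g)) (at t)"
    using has_derivative_compose [OF xc fc] .
  then have "((\<lambda>s. f (x s)) has_derivative (\<lambda>h. (h *\<^sub>R v) \<bullet> g)) (at t)"
  proof (rule has_derivative_transform_eventually)
    show "\<forall>\<^sub>F s in at t. f (inv_into V c (c (x s))) = f (x s)"
      using ev by eventually_elim (simp add: inv_into_chart [OF Vc(1)])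
  qed (simp_all add: inv_into_chart [OF Vc])
  then show ?thesis
    by (simp add: has_vector_derivative_def)
qed

end

section \<open>Derivatives of the Hamiltonian and of grid quantities in the particle
  variables\<close>

text \<open>Isolates the varied particle, so that all other summands are constant under
  differentiation.\<close>

lemma sum_fun_upd:
  fixes F :: "'n::finite \<Rightarrow> 'a \<Rightarrow> 'b::comm_monoid_add"
  shows "(\<Sum>\<gamma>\<in>UNIV. F \<gamma> ((f(\<beta> := y)) \<gamma>)) = F \<beta> y + (\<Sum>\<gamma>\<in>UNIV - {\<beta>}. F \<gamma> (f \<gamma>))"
  by (subst sum.remove [of _ \<beta>]) (auto intro!: sum.cong)

text \<open>Only the summand of particle \<open>\<beta>\<close> in \<open>M m\<close> depends on the
  varied momentum. Pairing its weights \<open>psi k (X \<beta>)\<close> with the grid velocity is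
  interpolation to the particle.\<close>

lemma grad_particle_Hhat_momentum:
  fixes X :: "'n::finite \<Rightarrow> 'p" and mb :: "'n \<Rightarrow> real^2"
  assumes leg: "legendre_solution M lam W U" and inv: "invertible M"
    and m: "m = to_grid M psi \<Delta>S X mb" and D: "D = to_grid M psi \<Delta>S X Db"
    and W: "(m, D) \<in> W"
  shows "grad (\<lambda>p. particle_Hhat M lam U psi \<Delta>S Db X (mb(\<beta> := p))) (mb \<beta>)
    = to_particle psi X (U m D) \<beta> /\<^sub>R \<Delta>S"
proof (rule grad_eqI)
  have b: "((\<lambda>p. \<Sum>\<gamma>\<in>UNIV. psi k (X \<gamma>) *\<^sub>R ((mb(\<beta> := p)) \<gamma> /\<^sub>R \<Delta>S)) has_derivative
      (\<lambda>h. psi k (X \<beta>) *\<^sub>R (h /\<^sub>R \<Delta>S))) (at (mb \<beta>))" for k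
    unfolding sum_fun_upd [where F = "\<lambda>\<gamma> v. psi k (X \<gamma>) *\<^sub>R (v /\<^sub>R \<Delta>S)"]
    by (auto intro!: derivative_eq_intros)
  \<comment> \<open>The factor \<open>0\<close> is the variation of the density sums, which contain
    no momenta.\<close>
  have "((\<lambda>p. particle_Hhat M lam U psi \<Delta>S Db X (mb(\<beta> := p))) has_derivative
     (\<lambda>h. (\<Sum>k\<in>UNIV. U m D $ k \<bullet> (psi k (X \<beta>) *\<^sub>R (h /\<^sub>R \<Delta>S)))
       - (\<Sum>k\<in>UNIV. Minv_dLhat_dD M lam (U m D) D $ k * 0))) (at (mb \<beta>))"
    unfolding particle_Hhat_def to_grid_def
    by (rule Hhat_mass_solve_has_derivative [OF leg inv b])
      (use W in \<open>simp_all add: m D to_grid_def\<close>)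
  moreover have "(\<Sum>k\<in>UNIV. U m D $ k \<bullet> (psi k (X \<beta>) *\<^sub>R (h /\<^sub>R \<Delta>S)))
     = h \<bullet> (to_particle psi X (U m D) \<beta> /\<^sub>R \<Delta>S)" for h
    by (simp add: to_particle_def inner_sum_right sum_distrib_left inner_commute mult_ac)
  ultimately show "GDERIV (\<lambda>p. particle_Hhat M lam U psi \<Delta>S Db X (mb(\<beta> := p))) (mb \<beta>)
      :> to_particle psi X (U m D) \<beta> /\<^sub>R \<Delta>S"
    by (simp add: gderiv_def)
qed

text \<open>A position enters both \<open>M m\<close> and \<open>M D\<close> through the basis
  functions. The momentum sum yields the transposed velocity gradient, the density sum the gradient
  of \<open>Minv_dLhat_dD\<close> with the opposite sign.\<close>

lemma (in closed_flat_surface) gradient_particle_Hhat_position: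
  fixes X :: "'n::finite \<Rightarrow> 'p" and mb :: "'n \<Rightarrow> real^2"
  assumes leg: "legendre_solution M lam W U" and inv: "invertible M"
    and m: "m = to_grid M psi \<Delta>S X mb" and D: "D = to_grid M psi \<Delta>S X Db"
    and W: "(m, D) \<in> W"
    and X: "X \<beta> \<in> topspace S"
    and psi: "\<And>k. has_surface_gradient atlas (psi k) (X \<beta>) (surface_gradient atlas (psi k) (X \<beta>))"
  shows "surface_gradient atlas (\<lambda>x. particle_Hhat M lam U psi \<Delta>S Db (X(\<beta> := x)) mb) (X \<beta>)
    = (gradT_to_particle atlas psi X (U m D) \<beta> (mb \<beta>)
       - Db \<beta> *\<^sub>R grad_to_particle atlas psi X (Minv_dLhat_dD M lam (U m D) D) \<beta>) /\<^sub>R \<Delta>S"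
    (is "_ = ?g")
proof (rule surface_gradient_eqI [OF X], unfold has_surface_gradient_def, clarify)
  fix V c
  assume Vc: "(V, c) \<in> atlas" "X \<beta> \<in> V"
  let ?G = "\<lambda>k. surface_gradient atlas (psi k) (X \<beta>)"
  have psi': "((\<lambda>y. psi k (inv_into V c y)) has_derivative (\<lambda>h. h \<bullet> ?G k)) (at (c (X \<beta>)))" for k
    using psi [of k] Vc unfolding has_surface_gradient_def gderiv_def by blast
  \<comment> \<open>Stated for values in any normed space, to serve both the vector momenta and the
    scalar densities.\<close>
  have b: "((\<lambda>y. \<Sum>\<gamma>\<in>UNIV. psi k ((X(\<beta> := inv_into V c y)) \<gamma>) *\<^sub>R (f \<gamma> /\<^sub>R \<Delta>S)) has_derivative
      (\<lambda>h. (h \<bullet> ?G k) *\<^sub>R (f \<beta> /\<^sub>R \<Delta>S))) (at (c (X \<beta>)))" for k and f :: "'n \<Rightarrow> 'v::real_normed_vector"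
    unfolding sum_fun_upd [where F = "\<lambda>\<gamma> x. psi k x *\<^sub>R (f \<gamma> /\<^sub>R \<Delta>S)"]
    by (auto intro!: derivative_eq_intros psi')
  have "((\<lambda>y. particle_Hhat M lam U psi \<Delta>S Db (X(\<beta> := inv_into V c y)) mb) has_derivative
     (\<lambda>h. (\<Sum>k\<in>UNIV. U m D $ k \<bullet> ((h \<bullet> ?G k) *\<^sub>R (mb \<beta> /\<^sub>R \<Delta>S)))
       - (\<Sum>k\<in>UNIV. Minv_dLhat_dD M lam (U m D) D $ k * ((h \<bullet> ?G k) *\<^sub>R (Db \<beta> /\<^sub>R \<Delta>S)))))
     (at (c (X \<beta>)))"
    unfolding particle_Hhat_def to_grid_def
    by (rule Hhat_mass_solve_has_derivative [OF leg inv b b])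
      (use W in \<open>simp_all add: m D to_grid_def inv_into_chart [OF Vc]\<close>)
  moreover have "(\<Sum>k\<in>UNIV. U m D $ k \<bullet> ((h \<bullet> ?G k) *\<^sub>R (mb \<beta> /\<^sub>R \<Delta>S)))
       - (\<Sum>k\<in>UNIV. Minv_dLhat_dD M lam (U m D) D $ k * ((h \<bullet> ?G k) *\<^sub>R (Db \<beta> /\<^sub>R \<Delta>S))) = h \<bullet> ?g" for h
    by (simp add: gradT_to_particle_def grad_to_particle_def inner_sum_right inner_diff_right
        sum_distrib_left right_diff_distrib mult_ac)
  ultimately show "GDERIV (\<lambda>y. particle_Hhat M lam U psi \<Delta>S Db (X(\<beta> := inv_into V c y)) mb) (c (X \<beta>)) :> ?g"
    by (simp add: gderiv_def)
qed

text \<open>By the product rule, the motion of the particles gives the first term, a divergence up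
  to sign, and the change of the carried quantity gives the second.\<close>

lemma (in closed_flat_surface) has_vector_derivative_to_grid:
  fixes X :: "real \<Rightarrow> 'n::finite \<Rightarrow> 'p" and f :: "real \<Rightarrow> 'n \<Rightarrow> 'v::real_normed_vector"
  assumes inv: "invertible M"
    and X: "\<And>\<beta>. X t \<beta> \<in> topspace S"
    and psi: "\<And>k \<beta>. has_surface_gradient atlas (psi k) (X t \<beta>) (surface_gradient atlas (psi k) (X t \<beta>))"
    and v: "\<And>\<beta>. has_surface_velocity S atlas (\<lambda>s. X s \<beta>) t (v \<beta>)"
    and f: "\<And>\<beta>. ((\<lambda>s. f s \<beta>) has_vector_derivative f' \<beta>) (at t)"
  shows "((\<lambda>s. to_grid M psi \<Delta>S (X s) (f s) $ k) has_vector_derivative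
     mass_solve M (\<lambda>k. \<Sum>\<beta>\<in>UNIV.
       (v \<beta> \<bullet> surface_gradient atlas (psi k) (X t \<beta>)) *\<^sub>R (f t \<beta> /\<^sub>R \<Delta>S)) $ k
     + to_grid M psi \<Delta>S (X t) f' $ k) (at t)"
proof -
  let ?G = "\<lambda>k \<beta>. surface_gradient atlas (psi k) (X t \<beta>)"
  have psi': "((\<lambda>s. psi k (X s \<beta>)) has_real_derivative v \<beta> \<bullet> ?G k \<beta>) (at t)" for k \<beta>
    using has_vector_derivative_along_curve [OF X psi v]
    by (simp add: has_real_derivative_iff_has_vector_derivative)
  have "((\<lambda>s. \<Sum>j\<in>UNIV. matrix_inv M $ k $ j *\<^sub>R (\<Sum>\<beta>\<in>UNIV. psi j (X s \<beta>) *\<^sub>R (f s \<beta> /\<^sub>R \<Delta>S)))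
     has_vector_derivative (\<Sum>j\<in>UNIV. matrix_inv M $ k $ j *\<^sub>R (\<Sum>\<beta>\<in>UNIV.
       psi j (X t \<beta>) *\<^sub>R (f' \<beta> /\<^sub>R \<Delta>S) + (v \<beta> \<bullet> ?G j \<beta>) *\<^sub>R (f t \<beta> /\<^sub>R \<Delta>S)))) (at t)"
    by (intro has_vector_derivative_sum
        bounded_linear.has_vector_derivative [OF bounded_linear_scaleR_right]
        has_vector_derivative_scaleR psi' f)
  then show ?thesis
    by (simp add: to_grid_def mass_solve_nth [OF inv] sum.distrib scaleR_right_distrib add.commute)
qed

section \<open>Equations of motion on the grid and at the particles\<close>

theorem theorem3p3:
  fixes S :: "'p topology"
    and atlas :: "('p set \<times> ('p \<Rightarrow> real^2)) set"
    and area :: "'p measure"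
    and \<phi> :: "'p \<Rightarrow> 'p \<Rightarrow> real"
    and \<Delta>S :: real
    and xg :: "'m::finite \<Rightarrow> 'p"
    and psi :: "'m \<Rightarrow> 'p \<Rightarrow> real"
    and M :: "real^'m^'m"
    and lam :: "'m \<Rightarrow> (real^2)^'m \<Rightarrow> real^'m \<Rightarrow> real"
    and W :: "(((real^2)^'m) \<times> (real^'m)) set"
    and U :: "(real^2)^'m \<Rightarrow> real^'m \<Rightarrow> (real^2)^'m"
    and Db :: "'n::finite \<Rightarrow> real"
    and T :: "real set"
    and X :: "real \<Rightarrow> 'n \<Rightarrow> 'p"
    and mb :: "real \<Rightarrow> 'n \<Rightarrow> real^2"
    and mg :: "real \<Rightarrow> (real^2)^'m"
    and Dg :: "real \<Rightarrow> real^'m"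
    and u :: "real \<Rightarrow> (real^2)^'m"
  assumes "closed_flat_surface S atlas area"
    and "\<And>k. xg k \<in> topspace S"
    and "\<And>k x. psi k x = \<phi> (xg k) x"
    and "\<And>x y. \<lbrakk>x \<in> topspace S; y \<in> topspace S\<rbrakk> \<Longrightarrow>
           \<exists>g. has_surface_gradient atlas (\<lambda>x'. \<phi> y x') x g \<and>
               has_surface_gradient atlas (\<lambda>y'. \<phi> y' x) y (- g)"
    and "\<And>y. y \<in> topspace S \<Longrightarrow> has_bochner_integral area (\<lambda>x. \<phi> x y) \<Delta>S"
    and "\<Delta>S \<noteq> 0"
    and "\<And>x. x \<in> topspace S \<Longrightarrow> (\<Sum>k\<in>UNIV. psi k x) = 1"
    and "invertible M"
    and "legendre_solution M lam W U"
    and "\<And>\<beta>. Db \<beta> \<noteq> 0"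
    and "open T" and "is_interval T"
    and "\<And>t \<beta>. t \<in> T \<Longrightarrow> X t \<beta> \<in> topspace S"
    and "\<And>t. mg t = to_grid M psi \<Delta>S (X t) (mb t)"
    and "\<And>t. Dg t = to_grid M psi \<Delta>S (X t) Db"
    and "\<And>t. t \<in> T \<Longrightarrow> (mg t, Dg t) \<in> W"
    and "\<And>t. u t = U (mg t) (Dg t)"
    and "\<And>t. t \<in> T \<Longrightarrow>
           hamilton_equations S atlas \<Delta>S (particle_Hhat M lam U psi \<Delta>S Db) X mb t"
  shows "\<forall>t\<in>T.
    (\<forall>k.
      ((\<lambda>s. to_grid M psi \<Delta>S (X s) (mb s) $ k) differentiable (at t) \<and>
       vector_derivative (\<lambda>s. to_grid M psi \<Delta>S (X s) (mb s) $ k) (at t)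
         + tensor_div_to_grid atlas M psi \<Delta>S (X t) (to_particle psi (X t) (u t)) (mb t) $ k
         + to_grid M psi \<Delta>S (X t)
             (\<lambda>\<beta>. gradT_to_particle atlas psi (X t) (u t) \<beta> (mb t \<beta>)) $ k
       = to_grid M psi \<Delta>S (X t)
           (\<lambda>\<beta>. Db \<beta> *\<^sub>R grad_to_particle atlas psi (X t)
                             (Minv_dLhat_dD M lam (u t) (Dg t)) \<beta>) $ k) \<and>
      ((\<lambda>s. to_grid M psi \<Delta>S (X s) Db $ k) differentiable (at t) \<and>
       vector_derivative (\<lambda>s. to_grid M psi \<Delta>S (X s) Db $ k) (at t)
         + div_to_grid atlas M psi \<Delta>S (X t) (\<lambda>\<beta>. Db \<beta> *\<^sub>R to_particle psi (X t) (u t) \<beta>) $ k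
       = 0) \<and>
      to_grid M psi \<Delta>S (X t) (mb t) $ k
        = (\<Sum>l\<in>UNIV. matrix_inv M $ k $ l *\<^sub>R dLhat_du M lam (u t) (Dg t) l)) \<and>
    (\<forall>\<beta>.
      ((\<lambda>s. mb s \<beta> /\<^sub>R Db \<beta>) differentiable (at t) \<and>
       vector_derivative (\<lambda>s. mb s \<beta> /\<^sub>R Db \<beta>) (at t)
         + gradT_to_particle atlas psi (X t) (u t) \<beta> (mb t \<beta> /\<^sub>R Db \<beta>)
       = grad_to_particle atlas psi (X t) (Minv_dLhat_dD M lam (u t) (Dg t)) \<beta>) \<and>
      has_surface_velocity S atlas (\<lambda>s. X s \<beta>) t (to_particle psi (X t) (u t) \<beta>))"
proof -
  interpret closed_flat_surface S atlas area by fact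
  \<comment> \<open>The kernel \<open>\<phi>\<close> has a gradient in its second argument, so
    \<open>surface_gradient\<close> denotes a true gradient of each basis function.\<close>
  have psi: "has_surface_gradient atlas (psi k) x (surface_gradient atlas (psi k) x)"
    if x: "x \<in> topspace S" for k x
  proof -
    have "psi k = \<phi> (xg k)"
      using assms(3) by auto
    then obtain g where "has_surface_gradient atlas (psi k) x g"
      using assms(4) [OF x assms(2) [of k]] by auto
    then show ?thesis
      using surface_gradient_eqI [OF x] by metis
  qed
  show ?thesis
  proof
    fix t
    assume t: "t \<in> T"
    note ham = assms(18) [OF t, unfolded hamilton_equations_def, rule_format]
    note leg = \<open>legendre_solution M lam W U\<close> and inv = \<open>invertible M\<close>
      and W = assms(16) [OF t] and X = assms(13) [OF t] and \<open>\<Delta>S \<noteq> 0\<close>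
    let ?v = "to_particle psi (X t) (u t)"
    let ?F = "grad_to_particle atlas psi (X t) (Minv_dLhat_dD M lam (u t) (Dg t))"
    let ?A = "gradT_to_particle atlas psi (X t) (u t)"
    \<comment> \<open>The rate of change of momentum that the second canonical equation prescribes,
      after cancelling \<open>\<Delta>S\<close>.\<close>
    define m' where "m' \<beta> = Db \<beta> *\<^sub>R ?F \<beta> - ?A \<beta> (mb t \<beta>)" for \<beta>
    \<comment> \<open>The factor \<open>\<Delta>S\<close> in the first canonical equation cancels
      the \<open>1 / \<Delta>S\<close> of the momentum gradient.\<close>
    have vel: "has_surface_velocity S atlas (\<lambda>s. X s \<beta>) t (?v \<beta>)" for \<beta>
      using ham [of \<beta>] \<open>\<Delta>S \<noteq> 0\<close>
      by (simp add: grad_particle_Hhat_momentum [OF leg inv assms(14) assms(15) W] assms(17))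
    have mom: "((\<lambda>s. mb s \<beta>) has_vector_derivative m' \<beta>) (at t)" for \<beta>
    proof -
      have "vector_derivative (\<lambda>s. mb s \<beta>) (at t) /\<^sub>R \<Delta>S = m' \<beta> /\<^sub>R \<Delta>S"
        using ham [of \<beta>]
        by (simp add: gradient_particle_Hhat_position [OF leg inv assms(14) assms(15) W X psi [OF X]]
            assms(17) m'_def flip: scaleR_minus_right)
      then have "vector_derivative (\<lambda>s. mb s \<beta>) (at t) = m' \<beta>"
        using \<open>\<Delta>S \<noteq> 0\<close> by simp
      with ham [of \<beta>] show ?thesis
        by (metis vector_derivative_works)
    qed
    \<comment> \<open>The divergence map carries a minus sign as the adjoint of the gradient map, so
      the transport term is minus a divergence.\<close>
    have grid_m: "((\<lambda>s. to_grid M psi \<Delta>S (X s) (mb s) $ k) has_vector_derivative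
        - tensor_div_to_grid atlas M psi \<Delta>S (X t) ?v (mb t) $ k + to_grid M psi \<Delta>S (X t) m' $ k) (at t)"
      for k
      using has_vector_derivative_to_grid [where f = mb and \<Delta>S = \<Delta>S and k = k, OF inv X psi [OF X] vel mom]
      by (simp add: tensor_div_to_grid_def mass_solve_nth [OF inv] sum_negf)
    \<comment> \<open>The particle densities are constant in time, so only transport
      remains.\<close>
    have grid_D: "((\<lambda>s. to_grid M psi \<Delta>S (X s) Db $ k) has_vector_derivative
        - div_to_grid atlas M psi \<Delta>S (X t) (\<lambda>\<beta>. Db \<beta> *\<^sub>R ?v \<beta>) $ k) (at t)" for k
      using has_vector_derivative_to_grid [where f = "\<lambda>_. Db" and f' = "\<lambda>_. 0" and \<Delta>S = \<Delta>S and k = k,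
          OF inv X psi [OF X] vel has_vector_derivative_const]
      by (simp add: div_to_grid_def to_grid_def mass_solve_nth [OF inv] sum_negf mult_ac)
    have rhs: "to_grid M psi \<Delta>S (X t) m' $ k
        = to_grid M psi \<Delta>S (X t) (\<lambda>\<beta>. Db \<beta> *\<^sub>R ?F \<beta>) $ k
          - to_grid M psi \<Delta>S (X t) (\<lambda>\<beta>. ?A \<beta> (mb t \<beta>)) $ k" for k
      by (simp add: to_grid_def mass_solve_nth [OF inv] m'_def scaleR_diff_right sum_subtractf)
    \<comment> \<open>The momentum relation is a linear system for \<open>mg t\<close>, and
      inverting \<open>M\<close> solves it.\<close>
    have legk: "to_grid M psi \<Delta>S (X t) (mb t) $ k
        = (\<Sum>l\<in>UNIV. matrix_inv M $ k $ l *\<^sub>R dLhat_du M lam (u t) (Dg t) l)" for k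
    proof -
      have "\<forall>k. (\<Sum>l\<in>UNIV. M $ k $ l *\<^sub>R mg t $ l) = dLhat_du M lam (u t) (Dg t) k"
        using leg W by (auto simp: legendre_solution_def assms(17))
      then have "mg t = mass_solve M (dLhat_du M lam (u t) (Dg t))"
        using mass_solve_iff [OF inv] by blast
      then show ?thesis
        by (simp flip: assms(14) add: mass_solve_nth [OF inv])
    qed
    have part: "((\<lambda>s. mb s \<beta> /\<^sub>R Db \<beta>) has_vector_derivative m' \<beta> /\<^sub>R Db \<beta>) (at t)" for \<beta>
      using mom by (rule bounded_linear.has_vector_derivative [OF bounded_linear_scaleR_right])
    \<comment> \<open>\<open>?A \<beta>\<close> is linear in its vector argument, so division by the
      nonzero density passes inside.\<close>
    have part_rhs: "m' \<beta> /\<^sub>R Db \<beta> = ?F \<beta> - ?A \<beta> (mb t \<beta> /\<^sub>R Db \<beta>)" for \<beta>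
      using assms(10) [of \<beta>]
      by (simp add: m'_def scaleR_diff_right gradT_to_particle_def scaleR_sum_right)
    show "(\<forall>k.
      ((\<lambda>s. to_grid M psi \<Delta>S (X s) (mb s) $ k) differentiable (at t) \<and>
       vector_derivative (\<lambda>s. to_grid M psi \<Delta>S (X s) (mb s) $ k) (at t)
         + tensor_div_to_grid atlas M psi \<Delta>S (X t) ?v (mb t) $ k
         + to_grid M psi \<Delta>S (X t) (\<lambda>\<beta>. ?A \<beta> (mb t \<beta>)) $ k
       = to_grid M psi \<Delta>S (X t) (\<lambda>\<beta>. Db \<beta> *\<^sub>R ?F \<beta>) $ k) \<and>
      ((\<lambda>s. to_grid M psi \<Delta>S (X s) Db $ k) differentiable (at t) \<and>
       vector_derivative (\<lambda>s. to_grid M psi \<Delta>S (X s) Db $ k) (at t)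
         + div_to_grid atlas M psi \<Delta>S (X t) (\<lambda>\<beta>. Db \<beta> *\<^sub>R ?v \<beta>) $ k = 0) \<and>
      to_grid M psi \<Delta>S (X t) (mb t) $ k
        = (\<Sum>l\<in>UNIV. matrix_inv M $ k $ l *\<^sub>R dLhat_du M lam (u t) (Dg t) l)) \<and>
    (\<forall>\<beta>.
      ((\<lambda>s. mb s \<beta> /\<^sub>R Db \<beta>) differentiable (at t) \<and>
       vector_derivative (\<lambda>s. mb s \<beta> /\<^sub>R Db \<beta>) (at t) + ?A \<beta> (mb t \<beta> /\<^sub>R Db \<beta>) = ?F \<beta>) \<and>
      has_surface_velocity S atlas (\<lambda>s. X s \<beta>) t (?v \<beta>))"
      by (simp add: legk vel rhs part_rhs differentiableI_vector [OF grid_m]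
          differentiableI_vector [OF grid_D] differentiableI_vector [OF part]
          vector_derivative_at [OF grid_m] vector_derivative_at [OF grid_D]
          vector_derivative_at [OF part])
  qed
qed

end
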